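(* Let $(\kappa_k)$ be a given solution of the Euler–Lagrange equation $$0=\mathrm{S}_{-3}(\alpha \mathrm{E}_\kappa(L))+\mathrm{S}_{-2}(\beta \mathrm{E}_\kappa(L))+\mathrm{S}_{-1}(\gamma \mathrm{E}_\kappa(L))+\delta \mathrm{E}_\kappa(L)$$ of a Lagrangian $\mathcal{L}[x]=\sum L(\kappa,\kappa_1,\dots,\kappa_J)$ invariant under the projective action of $SL(2)$, so that the vectors of invariants $\mathrm{S}_kV(I)=(V^1_k,V^2_k,V^3_k)$ in the conservation laws $\mathbf{k}=V(I)\,\mathcal{A}d(\rho_0)$ are known, and let the constants $\mathbf{k}=(k_1,k_2,k_3)$ in the conservation laws be given. Set $\mu=\sqrt{k_1^2+4k_2k_3}$ and assume $V^2_k\ne0$ for all $k$ and $k_3\mu\neq0$. Then the solution in terms of the original variable is $$x_k=\rho_k^{-1}\cdot\frac12=\frac{d_k-2b_k}{2a_k-c_k},$$ where $$\begin{pmatrix}c_k\\d_k\end{pmatrix}=Q\begin{pmatrix}\prod_{l=0}^{k-1}\lambda^1_l&0\\0&\prod_{l=0}^{k-1}\lambda^2_l\end{pmatrix}Q^{-1}\begin{pmatrix}c_0\\d_0\end{pmatrix},\qquad Q=\frac{1}{2\mu}\begin{pmatrix}\mu+k_1&\mu-k_1\\2k_3&-2k_3\end{pmatrix},$$ $c_0$ and $d_0$ are the initial data, $$\begin{aligned}\lambda^1_l&=\frac{1}{2\sqrt{\kappa_l-1}\,\sqrt{\kappa_l}\,V^2_l}\Big(-(3\kappa_l+1)(\mu+V^1_l)+(\kappa_l-1)V^2_l\Big),\\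 \lambda^2_l&=\frac{1}{2\sqrt{\kappa_l-1}\,\sqrt{\kappa_l}\,V^2_l}\Big((3\kappa_l+1)(\mu-V^1_l)+(\kappa_l-1)V^2_l\Big),\end{aligned}$$ and $a_k$, $b_k$ are determined by $$2b_kV^2_k-2c_kk_3+(k_1-V^1_k)d_k=0,\qquad 2a_kV^2_k-c_k(k_1+V^1_k)-2k_2d_k=0.$$
   Context: The group $SL(2)$ acts projectively, $x\mapsto g\cdot x=\dfrac{ax+b}{cx+d}$, $g=\begin{pmatrix}a&b\\c&d\end{pmatrix}$, $ad-bc=1$, and diagonally on sequences $(x_j)$, $j\in\mathbb{Z}$. $\mathrm{S}$ is the shift operator ($x_j\mapsto x_{j+1}$, extended to functions), $\mathrm{S}_k$ its $k$-th power; a subscript $k$ on an invariant denotes $\mathrm{S}_k$ applied to it. Expressions are considered where defined; square roots are with consistent (possibly complex) choices, and empty products equal $1$ ($k\ge0$). Generating invariant (cross ratio): $\kappa=\dfrac{(x_0-x_1)(x_2-x_3)}{(x_0-x_3)(x_2-x_1)}$. Discrete moving frame (normalisation $x_0\mapsto\frac12$, $x_1\mapsto0$, $x_2\mapsto-\frac12$): $$\rho_0=\frac{\sqrt{x_0-x_2}}{\sqrt{(x_0-x_1)(x_1-x_2)}}\begin{pmatrix}\frac12&-\frac{x_1}{2}\\ \frac{x_2-2x_1+x_0}{x_0-x_2}&\frac{x_0x_1-2x_0x_2+x_1x_2}{x_0-x_2}\end{pmatrix},\qquad \rho_k=\mathrm{S}_k\rho_0=\begin{pmatrix}a_k&b_k\\c_k&d_k\end{pmatrix},$$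 $$K_0=\rho_1\rho_0^{-1}=\sqrt{\frac{\kappa-1}{4\kappa}}\begin{pmatrix}1&\frac12\\-\frac{6\kappa+2}{\kappa-1}&1\end{pmatrix}.$$ In particular $(c_0,d_0)$ is the second row of $\rho_0$. Coefficients: $$\alpha=\frac{\kappa(\kappa-1)\kappa_1(\kappa_2-1)}{\kappa_2(\kappa_1-1)},\quad \beta=\frac{\kappa(\kappa_1-1)}{\kappa_1},\quad\gamma=-(\kappa-1),\quad\delta=-\kappa(\kappa-1),$$ and $\mathrm{E}_\kappa(L)=\sum_j\mathrm{S}_{-j}(\partial L/\partial\kappa_j)$ is the difference Euler operator; the displayed equation in the claim is the invariant form of the Euler–Lagrange equation of $\mathcal{L}$ with respect to $x$. Adjoint representation: $\mathcal{A}d(g)=\begin{pmatrix}ad+bc&-ac&bd\\-2ab&a^2&-b^2\\2cd&-c^2&d^2\end{pmatrix}$. Noether's conservation laws are $\mathbf{k}=V(I)\,\mathcal{A}d(\rho_0)$, with $\mathbf{k}=(k_1,k_2,k_3)$ a constant row vector and $V(I)=(V^1_0,V^2_0,V^3_0)$ the row vector of invariants $$\begin{aligned}V(I)=\big(1\ \ 1\ -\tfrac14\big)\Big\{&\mathrm{S}_{-1}(\gamma \mathrm{E}_\kappa(L))+\mathrm{S}_{-2}(\beta \mathrm{E}_\kappa(L))+\mathrm{S}_{-3}(\alpha \mathrm{E}_\kappa(L))\\&+\big(\mathrm{S}_{-1}(\beta \mathrm{E}_\kappa(L))+\mathrm{S}_{-2}(\alpha \mathrm{E}_\kappa(L))\big)\mathcal{A}d(K_0)+\mathrm{S}_{-1}(\alpha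 \mathrm{E}_\kappa(L))\,\mathcal{A}d(\mathrm{S}K_0)\,\mathcal{A}d(K_0)\Big\},\end{aligned}$$ where scalar terms multiply the identity matrix. *)

theory Defs
  imports "HOL-Analysis.Analysis"
begin

text \<open>
  Difference functions are functions of an integer index: for an expression \<open>f\<close> in the
  sequence, \<open>f k\<close> is the value of \<open>S_k f\<close>, so \<open>S_{-3} f\<close> evaluated at \<open>k\<close> is \<open>f (k - 3)\<close>.
  Everything lives in the complex numbers. Square roots enter as sequences \<open>p\<close>, \<open>q\<close>, \<open>u\<close>, \<open>v\<close>
  with prescribed squares, not through a fixed branch:
  \<open>p k ^ 2 = x k - x (k + 2)\<close>, \<open>q k ^ 2 = x k - x (k + 1)\<close>,
  \<open>u k ^ 2 = \<kappa> k - 1\<close>, \<open>v k ^ 2 = \<kappa> k\<close>.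
\<close>

definition mat2 :: "complex \<Rightarrow> complex \<Rightarrow> complex \<Rightarrow> complex \<Rightarrow> complex^2^2" where
  "mat2 a b c d = vector [vector [a, b], vector [c, d]]"

definition proj_act :: "complex^2^2 \<Rightarrow> complex \<Rightarrow> complex" where
  "proj_act g z = moebius (g $ 1 $ 1) (g $ 1 $ 2) (g $ 2 $ 1) (g $ 2 $ 2) z"

definition cross_ratio :: "(int \<Rightarrow> complex) \<Rightarrow> int \<Rightarrow> complex" where
  "cross_ratio x k =
     ((x k - x (k + 1)) * (x (k + 2) - x (k + 3))) /
     ((x k - x (k + 3)) * (x (k + 2) - x (k + 1)))"

definition moving_frame ::
  "(int \<Rightarrow> complex) \<Rightarrow> (int \<Rightarrow> complex) \<Rightarrow> (int \<Rightarrow> complex) \<Rightarrow> int \<Rightarrow> complex^2^2" where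
  "moving_frame p q x k =
     mat (p k / (q k * q (k + 1))) **
     mat2 (1/2) (- x (k + 1) / 2)
       ((x (k + 2) - 2 * x (k + 1) + x k) / (x k - x (k + 2)))
       ((x k * x (k + 1) - 2 * x k * x (k + 2) + x (k + 1) * x (k + 2)) / (x k - x (k + 2)))"

text \<open>The factor \<open>u k / (2 * v k)\<close> is the square root of \<open>(\<kappa> k - 1) / (4 * \<kappa> k)\<close>.\<close>

definition K_mat ::
  "(int \<Rightarrow> complex) \<Rightarrow> (int \<Rightarrow> complex) \<Rightarrow> (int \<Rightarrow> complex) \<Rightarrow> int \<Rightarrow> complex^2^2" where
  "K_mat u v \<kappa> k =
     mat (u k / (2 * v k)) ** mat2 1 (1/2) (- (6 * \<kappa> k + 2) / (\<kappa> k - 1)) 1"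

definition Ad :: "complex^2^2 \<Rightarrow> complex^3^3" where
  "Ad g = (let a = g $ 1 $ 1; b = g $ 1 $ 2; c = g $ 2 $ 1; d = g $ 2 $ 2 in
     vector [vector [a * d + b * c, - (a * c), b * d],
             vector [- 2 * a * b, a ^ 2, - (b ^ 2)],
             vector [2 * c * d, - (c ^ 2), d ^ 2]])"

definition coeff_alpha :: "(int \<Rightarrow> complex) \<Rightarrow> int \<Rightarrow> complex" where
  "coeff_alpha \<kappa> k =
     (\<kappa> k * (\<kappa> k - 1) * \<kappa> (k + 1) * (\<kappa> (k + 2) - 1)) / (\<kappa> (k + 2) * (\<kappa> (k + 1) - 1))"

definition coeff_beta :: "(int \<Rightarrow> complex) \<Rightarrow> int \<Rightarrow> complex" where
  "coeff_beta \<kappa> k = \<kappa> k * (\<kappa> (k + 1) - 1) / \<kappa> (k + 1)"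

definition coeff_gamma :: "(int \<Rightarrow> complex) \<Rightarrow> int \<Rightarrow> complex" where
  "coeff_gamma \<kappa> k = - (\<kappa> k - 1)"

definition coeff_delta :: "(int \<Rightarrow> complex) \<Rightarrow> int \<Rightarrow> complex" where
  "coeff_delta \<kappa> k = - \<kappa> k * (\<kappa> k - 1)"

text \<open>
  A Lagrangian \<open>L(\<kappa>, \<kappa>_1, \<dots>, \<kappa>_J)\<close> is a function on lists of length \<open>J + 1\<close>. The set \<open>\<F>\<close> is
  the range of its arguments, either \<open>\<real>\<close> (differentiability over the reals) or \<open>UNIV\<close>
  (complex differentiability).
\<close>

definition jet :: "nat \<Rightarrow> (int \<Rightarrow> complex) \<Rightarrow> int \<Rightarrow> complex list" where
  "jet J \<kappa> k = map (\<lambda>i. \<kappa> (k + int i)) [0..<J + 1]"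

definition has_partial ::
  "complex set \<Rightarrow> (complex list \<Rightarrow> complex) \<Rightarrow> nat \<Rightarrow> complex list \<Rightarrow> complex \<Rightarrow> bool" where
  "has_partial \<F> L j w D \<longleftrightarrow>
     ((\<lambda>z. L (w[j := z])) has_field_derivative D) (at (w ! j) within \<F>)"

definition partial_deriv ::
  "complex set \<Rightarrow> (complex list \<Rightarrow> complex) \<Rightarrow> nat \<Rightarrow> complex list \<Rightarrow> complex" where
  "partial_deriv \<F> L j w = (THE D. has_partial \<F> L j w D)"

definition euler_op ::
  "complex set \<Rightarrow> nat \<Rightarrow> (complex list \<Rightarrow> complex) \<Rightarrow> (int \<Rightarrow> complex) \<Rightarrow> int \<Rightarrow> complex" where
  "euler_op \<F> J L \<kappa> k = (\<Sum>j\<le>J. partial_deriv \<F> L j (jet J \<kappa> (k - int j)))"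

definition euler_lagrange ::
  "complex set \<Rightarrow> nat \<Rightarrow> (complex list \<Rightarrow> complex) \<Rightarrow> (int \<Rightarrow> complex) \<Rightarrow> bool" where
  "euler_lagrange \<F> J L \<kappa> \<longleftrightarrow> (let E = euler_op \<F> J L \<kappa> in
     \<forall>k. 0 = coeff_alpha \<kappa> (k - 3) * E (k - 3) + coeff_beta \<kappa> (k - 2) * E (k - 2)
           + coeff_gamma \<kappa> (k - 1) * E (k - 1) + coeff_delta \<kappa> k * E k)"

definition V_inv ::
  "complex set \<Rightarrow> nat \<Rightarrow> (complex list \<Rightarrow> complex) \<Rightarrow> (int \<Rightarrow> complex) \<Rightarrow> (int \<Rightarrow> complex) \<Rightarrow>
   (int \<Rightarrow> complex) \<Rightarrow> int \<Rightarrow> complex^3" where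
  "V_inv \<F> J L u v \<kappa> k = (let
       A = (\<lambda>i. coeff_alpha \<kappa> i * euler_op \<F> J L \<kappa> i);
       B = (\<lambda>i. coeff_beta \<kappa> i * euler_op \<F> J L \<kappa> i);
       C = (\<lambda>i. coeff_gamma \<kappa> i * euler_op \<F> J L \<kappa> i)
     in vector [1, 1, - (1/4)] v*
       (mat (C (k - 1) + B (k - 2) + A (k - 3))
        + mat (B (k - 1) + A (k - 2)) ** Ad (K_mat u v \<kappa> k)
        + mat (A (k - 1)) ** Ad (K_mat u v \<kappa> (k + 1)) ** Ad (K_mat u v \<kappa> k)))"

text \<open>In the following, \<open>V l\<close> is the row vector \<open>(V^1_l, V^2_l, V^3_l)\<close> and \<open>\<mu>\<close> is a square root
  of \<open>k_1^2 + 4 * k_2 * k_3\<close>, where \<open>(k_1, k_2, k_3) = cs\<close>.\<close>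

definition lambda1 ::
  "(int \<Rightarrow> complex) \<Rightarrow> (int \<Rightarrow> complex) \<Rightarrow> (int \<Rightarrow> complex) \<Rightarrow> (int \<Rightarrow> complex^3) \<Rightarrow> complex \<Rightarrow>
   int \<Rightarrow> complex" where
  "lambda1 u v \<kappa> V \<mu> l = 1 / (2 * u l * v l * V l $ 2) *
     (- (3 * \<kappa> l + 1) * (\<mu> + V l $ 1) + (\<kappa> l - 1) * V l $ 2)"

definition lambda2 ::
  "(int \<Rightarrow> complex) \<Rightarrow> (int \<Rightarrow> complex) \<Rightarrow> (int \<Rightarrow> complex) \<Rightarrow> (int \<Rightarrow> complex^3) \<Rightarrow> complex \<Rightarrow>
   int \<Rightarrow> complex" where
  "lambda2 u v \<kappa> V \<mu> l = 1 / (2 * u l * v l * V l $ 2) *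
     ((3 * \<kappa> l + 1) * (\<mu> - V l $ 1) + (\<kappa> l - 1) * V l $ 2)"

definition Q_mat :: "complex^3 \<Rightarrow> complex \<Rightarrow> complex^2^2" where
  "Q_mat cs \<mu> =
     mat (1 / (2 * \<mu>)) ** mat2 (\<mu> + cs $ 1) (\<mu> - cs $ 1) (2 * cs $ 3) (- 2 * cs $ 3)"

definition frame_formulas ::
  "(int \<Rightarrow> complex) \<Rightarrow> (int \<Rightarrow> complex) \<Rightarrow> (int \<Rightarrow> complex) \<Rightarrow> (int \<Rightarrow> complex^3) \<Rightarrow> complex^3 \<Rightarrow>
   complex \<Rightarrow> (nat \<Rightarrow> complex) \<Rightarrow> (nat \<Rightarrow> complex) \<Rightarrow> (nat \<Rightarrow> complex) \<Rightarrow> (nat \<Rightarrow> complex) \<Rightarrow> bool"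
  where
  "frame_formulas u v \<kappa> V cs \<mu> a b c d \<longleftrightarrow> (\<forall>k.
     (vector [c k, d k] :: complex^2) =
       (Q_mat cs \<mu>
         ** mat2 (\<Prod>l<k. lambda1 u v \<kappa> V \<mu> (int l)) 0 0 (\<Prod>l<k. lambda2 u v \<kappa> V \<mu> (int l))
         ** matrix_inv (Q_mat cs \<mu>)) *v vector [c 0, d 0] \<and>
     2 * b k * V (int k) $ 2 - 2 * c k * cs $ 3 + (cs $ 1 - V (int k) $ 1) * d k = 0 \<and>
     2 * a k * V (int k) $ 2 - c k * (cs $ 1 + V (int k) $ 1) - 2 * cs $ 2 * d k = 0)"

end

theory Submission
  imports Defs
begin

text \<open>
  Write \<open>K\<^sub>k\<close> for \<open>K_mat u v \<kappa> k\<close>, \<open>w = (1, -1/2)\<close> and \<open>sq (m, n) = (-2 m n, m^2, -n^2)\<close>.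

  The conservation laws hold because \<open>\<A>d\<close> acts on the vectors \<open>sq r\<close> by \<open>sq r \<A>d(g) = sq (r g)\<close>
  and the row \<open>(1, 1, -1/4)\<close> in \<open>V\<close> is \<open>sq w\<close>. The zero of the linear form \<open>w g\<close> is the point
  \<open>g\<^sup>-\<^sup>1 \<cdot> 1/2\<close>, so the squares \<open>sq w\<close>, \<open>sq (w K\<^sub>k)\<close>, \<open>sq (w K\<^sub>k\<^sub>+\<^sub>1 K\<^sub>k)\<close>,
  \<open>sq (w K\<^sub>k\<^sub>+\<^sub>2 K\<^sub>k\<^sub>+\<^sub>1 K\<^sub>k)\<close> stand for four consecutive points of the sequence. They are four
  vectors in dimension three, and \<open>\<delta>, \<gamma>, \<beta>, \<alpha>\<close> are the coefficients of their linear relation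
  (\<open>sq_row_relation\<close>). Together with the Euler--Lagrange equation this relation gives
  \<open>V (k + 1) \<A>d(K\<^sub>k) = V k\<close> (\<open>V_inv_step\<close>). Hence \<open>V k \<A>d(\<rho>\<^sub>k)\<close> is constant along every
  sequence of matrices with \<open>\<rho>\<^sub>k\<^sub>+\<^sub>1 = K\<^sub>k \<rho>\<^sub>k\<close>.

  If the constant is \<open>cs\<close> and \<open>det \<rho>\<^sub>k = 1\<close>, then the relation \<open>cs = V k \<A>d(\<rho>\<^sub>k)\<close> contains two
  equations that are linear in the entries of \<open>\<rho>\<^sub>k\<close> and determine its first row from its second.
  Substituted in \<open>\<rho>\<^sub>k\<^sub>+\<^sub>1 = K\<^sub>k \<rho>\<^sub>k\<close>, they turn the second row into the solution of a linear
  recursion in dimension two. Its matrix has the form \<open>s (1 + m (V\<^sup>1 + N))\<close> where only the scalars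
  \<open>s\<close>, \<open>m\<close> and \<open>V\<^sup>1\<close> depend on \<open>k\<close>, and \<open>N\<close> is the trace-free matrix with rows
  \<open>(k\<^sub>1, 2 k\<^sub>2)\<close>, \<open>(2 k\<^sub>3, -k\<^sub>1)\<close>, which has the eigenvalues \<open>\<mu>\<close> and \<open>-\<mu>\<close>. So one
  matrix \<open>Q\<close> diagonalises all steps at once, and the solution is a product of eigenvalues
  (\<open>frame_formulas_of_recursion\<close>).

  For the first half of the theorem it remains to see that the moving frame of a solution satisfies
  \<open>\<rho>\<^sub>k\<^sub>+\<^sub>1 = K\<^sub>k \<rho>\<^sub>k\<close> (\<open>moving_frame_step\<close>). For the second half, the formulas have only one
  solution with given initial data (\<open>frame_formulas_unique\<close>), so they describe the matrices
  \<open>K\<^sub>k\<^sub>-\<^sub>1 \<dots> K\<^sub>0 \<rho>\<^sub>0\<close>; the cross ratio of the points \<open>\<rho>\<^sub>k\<^sup>-\<^sup>1 \<cdot> 1/2\<close> is then a function of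
  the \<open>K\<^sub>k\<close> alone (\<open>cross_ratio_of_frame\<close>).
\<close>

section \<open>Matrices in dimension two\<close>

lemma mat2_nth [simp]:
  "mat2 a b c d $ 1 $ 1 = a" "mat2 a b c d $ 1 $ 2 = b"
  "mat2 a b c d $ 2 $ 1 = c" "mat2 a b c d $ 2 $ 2 = d"
  by (simp_all add: mat2_def)

lemma mat2_eta: "g = mat2 (g $ 1 $ 1) (g $ 1 $ 2) (g $ 2 $ 1) (g $ 2 $ 2)"
  by (simp add: vec_eq_iff forall_2)

lemma mat2_eq_iff: "mat2 a b c d = mat2 a' b' c' d' \<longleftrightarrow> a = a' \<and> b = b' \<and> c = c' \<and> d = d'"
  by (auto simp: vec_eq_iff forall_2)

lemma mat2_mult:
  "mat2 a b c d ** mat2 a' b' c' d' =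
     mat2 (a * a' + b * c') (a * b' + b * d') (c * a' + d * c') (c * b' + d * d')"
  by (simp add: vec_eq_iff forall_2 matrix_matrix_mult_def sum_2)

lemma scale_mat2: "mat s ** mat2 a b c d = mat2 (s * a) (s * b) (s * c) (s * d)"
  by (simp add: vec_eq_iff forall_2 matrix_matrix_mult_def sum_2 mat_def)

lemma mat_1_mat2: "mat 1 = mat2 1 0 0 1"
  by (simp add: vec_eq_iff forall_2 mat_def)

lemma det_mat2: "det (mat2 a b c d) = a * d - b * c"
  by (simp add: det_2)

lemma mat2_mult_vector: "mat2 a b c d *v vector [m, n] = vector [a * m + b * n, c * m + d * n]"
  by (simp add: vec_eq_iff forall_2 matrix_vector_mult_def sum_2)

lemma vector_mult_mat2: "vector [m, n] v* mat2 a b c d = vector [m * a + n * c, m * b + n * d]"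
  by (simp add: vec_eq_iff forall_2 vector_matrix_mult_def sum_2 mult.commute)

lemma vector_mult_scale: "r v* (mat (s :: 'a :: comm_ring_1) ** A) = s *s (r v* A)"
  by (simp add: vec_eq_iff vector_matrix_mult_def matrix_matrix_mult_def mat_def
        if_distrib if_distribR sum_distrib_left mult_ac cong: if_cong)

lemma vector_mult_mat: "r v* mat (s :: 'a :: comm_ring_1) = s *s r"
  using vector_mult_scale[of r s "mat 1"] by simp

lemma vector_smult_mult: "(s *s r) v* A = (s :: 'a :: comm_ring_1) *s (r v* A)"
  by (simp add: vec_eq_iff vector_matrix_mult_def sum_distrib_left mult_ac)

lemma matrix_inv_mult:
  fixes A :: "'a :: field^'n^'n"
  assumes "det A \<noteq> 0"
  shows "A ** matrix_inv A = mat 1" "matrix_inv A ** A = mat 1"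
proof -
  have "\<exists>B. A ** B = mat 1 \<and> B ** A = mat 1"
    using assms by (simp add: invertible_def flip: invertible_det_nz)
  from someI_ex[OF this] show "A ** matrix_inv A = mat 1" "matrix_inv A ** A = mat 1"
    by (simp_all add: matrix_inv_def)
qed

lemma matrix_inv_mat2:
  assumes "a * d - b * c = 1"
  shows "matrix_inv (mat2 a b c d) = mat2 d (- b) (- c) a"
proof -
  have "mat2 d (- b) (- c) a = mat2 d (- b) (- c) a ** (mat2 a b c d ** matrix_inv (mat2 a b c d))"
    using assms by (simp add: matrix_inv_mult det_mat2)
  also have "\<dots> = matrix_inv (mat2 a b c d)"
    using assms by (simp add: matrix_mul_assoc mat2_mult mult.commute flip: mat_1_mat2)
  finally show ?thesis ..
qed

section \<open>The adjoint representation on squares of linear forms\<close>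

text \<open>The square of the linear form \<open>m z + n\<close>, in the basis of quadratic forms on which the
  adjoint representation acts by substitution.\<close>

definition sq_row :: "complex^2 \<Rightarrow> complex^3" where
  "sq_row r = vector [- 2 * r $ 1 * r $ 2, (r $ 1) ^ 2, - ((r $ 2) ^ 2)]"

lemma sq_row_Ad: "sq_row r v* Ad g = sq_row (r v* g)"
  by (simp add: vec_eq_iff forall_2 forall_3 vector_matrix_mult_def sum_2 sum_3 sq_row_def Ad_def
        Let_def algebra_simps power2_eq_square)

lemma sq_row_scale: "sq_row (s *s r) = s ^ 2 *s sq_row r"
  by (simp add: vec_eq_iff forall_3 sq_row_def power2_eq_square)

lemma Ad_mult: "Ad (g ** h) = Ad g ** Ad h"
  by (simp add: vec_eq_iff forall_2 forall_3 matrix_matrix_mult_def sum_2 sum_3 Ad_def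
        Let_def algebra_simps power2_eq_square)

text \<open>The relation \<open>cs = V \<A>d(g)\<close> is quadratic in \<open>g\<close>. For \<open>det g = 1\<close> these are two entries of
  the equivalent statement that \<open>g\<close> intertwines the trace-free matrices of \<open>cs\<close> and \<open>V\<close>, which is linear
  in \<open>g\<close>.\<close>

lemma Ad_linear_relations:
  assumes "a * d - b * c = 1" and "cs = V v* Ad (mat2 a b c d)"
  shows "2 * b * V $ 2 - 2 * c * cs $ 3 + (cs $ 1 - V $ 1) * d = 0"
    and "2 * a * V $ 2 - c * (cs $ 1 + V $ 1) - 2 * cs $ 2 * d = 0"
proof -
  have cs: "cs $ 1 = V $ 1 * (a * d + b * c) - 2 * a * b * V $ 2 + 2 * c * d * V $ 3"
    "cs $ 2 = - (a * c) * V $ 1 + a^2 * V $ 2 - c^2 * V $ 3"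
    "cs $ 3 = b * d * V $ 1 - b^2 * V $ 2 + d^2 * V $ 3"
    using assms(2) by (simp_all add: vector_matrix_mult_def sum_3 Ad_def Let_def mult_ac)
  show "2 * b * V $ 2 - 2 * c * cs $ 3 + (cs $ 1 - V $ 1) * d = 0"
    "2 * a * V $ 2 - c * (cs $ 1 + V $ 1) - 2 * cs $ 2 * d = 0"
    unfolding cs using assms(1) by algebra+
qed

section \<open>The conservation laws\<close>

text \<open>Up to a factor the linear form that vanishes at the point \<open>1/2\<close>, to which the frame moves
  \<open>x\<^sub>0\<close>.\<close>

abbreviation frame_row :: "complex^2" where "frame_row \<equiv> vector [1, - (1/2)]"

text \<open>The form obtained vanishes at \<open>0\<close>, the point to which the frame moves \<open>x\<^sub>1\<close>. The next two
  lemmas follow \<open>x\<^sub>2\<close> and \<open>x\<^sub>3\<close> in the same way, so that products of up to three matrices \<open>K\<close>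
  applied to \<open>frame_row\<close> stay multiples of simple rows.\<close>

lemma frame_row_mult_K:
  assumes "\<kappa> k \<noteq> 1"
  shows "frame_row v* K_mat u v \<kappa> k = (u k / (2 * v k) * (4 * \<kappa> k / (\<kappa> k - 1))) *s vector [1, 0]"
  using assms unfolding K_mat_def vector_mult_scale vector_mult_mat2 vector_smult_assoc[symmetric]
  by (intro arg_cong[where f = "(*s) (u k / (2 * v k))"])
     (simp add: vec_eq_iff forall_2 divide_simps)

lemma e1_mult_K: "vector [1, 0] v* K_mat u v \<kappa> k = (u k / (2 * v k)) *s vector [1, 1/2]"
  by (simp add: K_mat_def scale_mat2 vector_mult_mat2 vec_eq_iff forall_2)

lemma row_1_half_mult_K:
  assumes "\<kappa> k \<noteq> 1"
  shows "vector [1, 1/2] v* K_mat u v \<kappa> k =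
    (u k / (2 * v k)) *s vector [- (2 * \<kappa> k + 2) / (\<kappa> k - 1), 1]"
  using assms unfolding K_mat_def vector_mult_scale vector_mult_mat2
  by (intro arg_cong[where f = "(*s) (u k / (2 * v k))"])
     (simp add: vec_eq_iff forall_2 divide_simps, simp add: algebra_simps)

lemma frame_row_mult_K_K:
  assumes "\<And>j. \<kappa> j \<noteq> 1"
  shows "frame_row v* K_mat u v \<kappa> (k + 1) v* K_mat u v \<kappa> k =
      (u (k+1) / (2 * v (k+1)) * (4 * \<kappa> (k+1) / (\<kappa> (k+1) - 1)) * (u k / (2 * v k))) *s vector [1, 1/2]"
   and "frame_row v* K_mat u v \<kappa> (k + 2) v* K_mat u v \<kappa> (k + 1) v* K_mat u v \<kappa> k =
      (u (k+2) / (2 * v (k+2)) * (4 * \<kappa> (k+2) / (\<kappa> (k+2) - 1)) * (u (k+1) / (2 * v (k+1)))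
        * (u k / (2 * v k))) *s vector [- (2 * \<kappa> k + 2) / (\<kappa> k - 1), 1]"
  using assms by (simp_all add: frame_row_mult_K e1_mult_K row_1_half_mult_K vector_smult_mult)

lemma det_K_mat:
  assumes "\<kappa> k \<noteq> 0" "\<kappa> k \<noteq> 1" "u k ^ 2 = \<kappa> k - 1" "v k ^ 2 = \<kappa> k"
  shows "det (K_mat u v \<kappa> k) = 1"
proof -
  have "det (K_mat u v \<kappa> k) = u k ^ 2 / (4 * v k ^ 2) * (1 + (3 * \<kappa> k + 1) / (\<kappa> k - 1))"
    unfolding K_mat_def scale_mat2 det_mat2 using assms(2)
    by (simp add: power_divide power2_eq_square divide_simps) (simp add: algebra_simps)
  also have "\<dots> = 1" using assms(1,2) unfolding assms(3,4) by (simp add: divide_simps)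
  finally show ?thesis .
qed

text \<open>Since only squares of \<open>u / (2 v)\<close> enter, the relation is rational in \<open>\<kappa>\<close>. The coefficients
  \<open>\<gamma>\<close>, \<open>\<beta>\<close>, \<open>\<alpha>\<close> cancel the scalar factors of the rows, and a
  relation with coefficients in \<open>\<kappa> k\<close> alone remains.\<close>

lemma sq_row_relation:
  assumes nz: "\<And>j. \<kappa> j \<noteq> 0" "\<And>j. \<kappa> j \<noteq> 1"
    and sq: "\<And>j. u j ^ 2 = \<kappa> j - 1" "\<And>j. v j ^ 2 = \<kappa> j"
  shows "coeff_delta \<kappa> k *s sq_row frame_row
      + coeff_gamma \<kappa> k *s sq_row (frame_row v* K_mat u v \<kappa> k)
      + coeff_beta \<kappa> k *s sq_row (frame_row v* K_mat u v \<kappa> (k + 1) v* K_mat u v \<kappa> k)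
      + coeff_alpha \<kappa> k *s sq_row (frame_row v* K_mat u v \<kappa> (k + 2) v* K_mat u v \<kappa> (k + 1)
          v* K_mat u v \<kappa> k) = 0"
proof -
  note a = nz(1)[of k] nz(1)[of "k+1"] nz(1)[of "k+2"] nz(2)[of k] nz(2)[of "k+1"] nz(2)[of "k+2"]
  have 1: "coeff_gamma \<kappa> k *s sq_row (frame_row v* K_mat u v \<kappa> k) =
      (- 4 * \<kappa> k) *s sq_row (vector [1, 0])"
    unfolding frame_row_mult_K[OF nz(2)] sq_row_scale power_mult_distrib power_divide sq coeff_gamma_def
    unfolding vector_smult_assoc using a
    by (intro arg_cong[where f = "\<lambda>s. s *s _"]) (simp add: divide_simps power2_eq_square, simp add: algebra_simps)
  have 2: "coeff_beta \<kappa> k *s sq_row (frame_row v* K_mat u v \<kappa> (k + 1) v* K_mat u v \<kappa> k) =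
      (\<kappa> k - 1) *s sq_row (vector [1, 1/2])"
    unfolding frame_row_mult_K_K[OF nz(2)] sq_row_scale power_mult_distrib power_divide sq coeff_beta_def
    unfolding vector_smult_assoc using a
    by (intro arg_cong[where f = "\<lambda>s. s *s _"]) (simp add: divide_simps power2_eq_square)
  have 3: "coeff_alpha \<kappa> k *s sq_row (frame_row v* K_mat u v \<kappa> (k + 2) v* K_mat u v \<kappa> (k + 1)
        v* K_mat u v \<kappa> k) = ((\<kappa> k - 1)^2 / 4) *s sq_row (vector [- (2 * \<kappa> k + 2) / (\<kappa> k - 1), 1])"
    unfolding frame_row_mult_K_K[OF nz(2)] sq_row_scale power_mult_distrib power_divide sq coeff_alpha_def
    unfolding vector_smult_assoc using a
    by (intro arg_cong[where f = "\<lambda>s. s *s _"]) (simp add: divide_simps power2_eq_square, simp add: algebra_simps)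
  show ?thesis unfolding 1 2 3 using a
    by (simp add: sq_row_def coeff_delta_def vec_eq_iff forall_3 divide_simps power2_eq_square) (simp add: algebra_simps)
qed

lemma V_inv_eq:
  fixes \<F> J L \<kappa>
  defines "E \<equiv> euler_op \<F> J L \<kappa>"
  shows "V_inv \<F> J L u v \<kappa> k =
      (coeff_gamma \<kappa> (k - 1) * E (k - 1) + coeff_beta \<kappa> (k - 2) * E (k - 2)
        + coeff_alpha \<kappa> (k - 3) * E (k - 3)) *s sq_row frame_row
    + (coeff_beta \<kappa> (k - 1) * E (k - 1) + coeff_alpha \<kappa> (k - 2) * E (k - 2))
        *s sq_row (frame_row v* K_mat u v \<kappa> k)
    + (coeff_alpha \<kappa> (k - 1) * E (k - 1))
        *s sq_row (frame_row v* K_mat u v \<kappa> (k + 1) v* K_mat u v \<kappa> k)"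
proof -
  have w: "(vector [1, 1, - (1/4)] :: complex^3) = sq_row frame_row"
    by (simp add: sq_row_def power2_eq_square)
  show ?thesis
    unfolding V_inv_def Let_def E_def w
    by (simp add: vector_matrix_mult_add_rdistrib vector_mult_scale vector_mult_mat sq_row_Ad
          vector_matrix_left_distrib vector_smult_mult flip: vector_matrix_mul_assoc)
qed

text \<open>The shift moves every term of \<open>V\<close> except the first one to the next power of \<open>K\<close>. The
  Euler--Lagrange equation replaces that first term by \<open>- \<delta> E\<close>, and the difference of the two
  sides becomes \<open>E k\<close> times the relation between the squares.\<close>

lemma V_inv_step:
  assumes nz: "\<And>j. \<kappa> j \<noteq> 0" "\<And>j. \<kappa> j \<noteq> 1"
    and sq: "\<And>j. u j ^ 2 = \<kappa> j - 1" "\<And>j. v j ^ 2 = \<kappa> j"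
    and EL: "euler_lagrange \<F> J L \<kappa>"
  shows "V_inv \<F> J L u v \<kappa> (k + 1) v* Ad (K_mat u v \<kappa> k) = V_inv \<F> J L u v \<kappa> k"
proof -
  define E where "E = euler_op \<F> J L \<kappa>"
  define R0 where "R0 = sq_row frame_row"
  define R1 where "R1 = sq_row (frame_row v* K_mat u v \<kappa> k)"
  define R2 where "R2 = sq_row (frame_row v* K_mat u v \<kappa> (k + 1) v* K_mat u v \<kappa> k)"
  define R3 where "R3 = sq_row (frame_row v* K_mat u v \<kappa> (k + 2) v* K_mat u v \<kappa> (k + 1)
      v* K_mat u v \<kappa> k)"
  have EL': "coeff_gamma \<kappa> (k - 1) * E (k - 1) + coeff_beta \<kappa> (k - 2) * E (k - 2)
      + coeff_alpha \<kappa> (k - 3) * E (k - 3) = - (coeff_delta \<kappa> k * E k)"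
    using EL unfolding euler_lagrange_def Let_def E_def[symmetric]
    by (metis (no_types, lifting) add.commute add.left_commute add_eq_0_iff)
  have V0: "V_inv \<F> J L u v \<kappa> k = (- (coeff_delta \<kappa> k * E k)) *s R0
      + (coeff_beta \<kappa> (k - 1) * E (k - 1) + coeff_alpha \<kappa> (k - 2) * E (k - 2)) *s R1
      + (coeff_alpha \<kappa> (k - 1) * E (k - 1)) *s R2"
    unfolding V_inv_eq E_def[symmetric] EL' R0_def R1_def R2_def ..
  have e: "k + 1 - 1 = k" "k + 1 - 2 = k - 1" "k + 1 - 3 = k - 2" "k + 1 + 1 = k + 2" by simp_all
  have V1: "V_inv \<F> J L u v \<kappa> (k + 1) v* Ad (K_mat u v \<kappa> k) =
      (coeff_gamma \<kappa> k * E k + coeff_beta \<kappa> (k - 1) * E (k - 1)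
        + coeff_alpha \<kappa> (k - 2) * E (k - 2)) *s R1
    + (coeff_beta \<kappa> k * E k + coeff_alpha \<kappa> (k - 1) * E (k - 1)) *s R2
    + (coeff_alpha \<kappa> k * E k) *s R3"
    unfolding V_inv_eq E_def[symmetric] R1_def R2_def R3_def e
    by (simp add: vector_matrix_left_distrib vector_smult_mult sq_row_Ad)
  have "coeff_delta \<kappa> k *s R0 + coeff_gamma \<kappa> k *s R1 + coeff_beta \<kappa> k *s R2
      + coeff_alpha \<kappa> k *s R3 = 0"
    unfolding R0_def R1_def R2_def R3_def by (rule sq_row_relation[OF nz sq])
  hence R: "coeff_delta \<kappa> k * R0 $ i + coeff_gamma \<kappa> k * R1 $ i + coeff_beta \<kappa> k * R2 $ i
      + coeff_alpha \<kappa> k * R3 $ i = 0" for i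
    by (simp add: vec_eq_iff)
  show ?thesis unfolding V0 V1 vec_eq_iff
  proof
    fix i
    show "((coeff_gamma \<kappa> k * E k + coeff_beta \<kappa> (k - 1) * E (k - 1)
        + coeff_alpha \<kappa> (k - 2) * E (k - 2)) *s R1
      + (coeff_beta \<kappa> k * E k + coeff_alpha \<kappa> (k - 1) * E (k - 1)) *s R2
      + (coeff_alpha \<kappa> k * E k) *s R3) $ i =
      ((- (coeff_delta \<kappa> k * E k)) *s R0
      + (coeff_beta \<kappa> (k - 1) * E (k - 1) + coeff_alpha \<kappa> (k - 2) * E (k - 2)) *s R1
      + (coeff_alpha \<kappa> (k - 1) * E (k - 1)) *s R2) $ i"
      using R[of i] by (simp) algebra
  qed
qed

section \<open>The linear recursion for the second row\<close>

text \<open>The step matrix for the second row \<open>(c, d)\<close> of the frame, once its first row has been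
  eliminated with the linear relations.\<close>

definition row_step :: "(int \<Rightarrow> complex) \<Rightarrow> (int \<Rightarrow> complex) \<Rightarrow> (int \<Rightarrow> complex) \<Rightarrow>
    (int \<Rightarrow> complex^3) \<Rightarrow> complex^3 \<Rightarrow> int \<Rightarrow> complex^2^2" where
  "row_step u v \<kappa> V cs l = (let m = - (3 * \<kappa> l + 1) / ((\<kappa> l - 1) * V l $ 2) in
     mat (u l / (2 * v l)) **
       mat2 (1 + m * (cs $ 1 + V l $ 1)) (m * (2 * cs $ 2))
         (m * (2 * cs $ 3)) (1 + m * (V l $ 1 - cs $ 1)))"

lemma second_row_step:
  assumes "V l $ 2 \<noteq> 0"
    and "2 * b * V l $ 2 - 2 * c * cs $ 3 + (cs $ 1 - V l $ 1) * d = 0"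
    and "2 * a * V l $ 2 - c * (cs $ 1 + V l $ 1) - 2 * cs $ 2 * d = 0"
    and "K_mat u v \<kappa> l ** mat2 a b c d = mat2 a' b' c' d'"
  shows "vector [c', d'] = row_step u v \<kappa> V cs l *v vector [c, d]"
proof -
  define m where "m = - (3 * \<kappa> l + 1) / ((\<kappa> l - 1) * V l $ 2)"
  have m: "- (6 * \<kappa> l + 2) / (\<kappa> l - 1) = m * (2 * V l $ 2)"
    using assms(1) by (cases "\<kappa> l = 1") (simp_all add: m_def divide_simps, algebra?)
  have ab: "2 * V l $ 2 * a = c * (cs $ 1 + V l $ 1) + 2 * cs $ 2 * d"
    "2 * V l $ 2 * b = 2 * c * cs $ 3 - (cs $ 1 - V l $ 1) * d"
    using assms(2,3) by algebra+
  define s where "s = u l / (2 * v l)"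
  have "c' = s * (m * (2 * V l $ 2 * a) + c)" "d' = s * (m * (2 * V l $ 2 * b) + d)"
    using assms(4) unfolding K_mat_def m scale_mat2 mat2_mult mat2_eq_iff s_def[symmetric]
    by (auto simp: algebra_simps)
  thus ?thesis
    unfolding row_step_def Let_def m_def[symmetric] s_def[symmetric] scale_mat2 mat2_mult_vector ab
    by (intro arg_cong2[where f = "\<lambda>x y. vector [x, y]"]; algebra)
qed

text \<open>The columns of \<open>Q\<close> are eigenvectors of the matrix with rows \<open>(k\<^sub>1, 2 k\<^sub>2)\<close> and
  \<open>(2 k\<^sub>3, -k\<^sub>1)\<close>, which does not depend on \<open>l\<close>; \<open>u / (\<kappa> - 1) = 1 / u\<close> brings the
  eigenvalues into the form of \<open>lambda1\<close> and \<open>lambda2\<close>.\<close>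

lemma row_step_Q:
  assumes "\<kappa> l \<noteq> 0" "\<kappa> l \<noteq> 1" "u l ^ 2 = \<kappa> l - 1" "v l ^ 2 = \<kappa> l"
    and "V l $ 2 \<noteq> 0"
    and mu: "\<mu> ^ 2 = (cs $ 1) ^ 2 + 4 * cs $ 2 * cs $ 3"
  shows "row_step u v \<kappa> V cs l ** Q_mat cs \<mu> =
      Q_mat cs \<mu> ** mat2 (lambda1 u v \<kappa> V \<mu> l) 0 0 (lambda2 u v \<kappa> V \<mu> l)"
proof -
  define m where "m = - (3 * \<kappa> l + 1) / ((\<kappa> l - 1) * V l $ 2)"
  define s where "s = u l / (2 * v l)"
  have uv: "u l \<noteq> 0" "v l \<noteq> 0" using assms by auto
  have s: "1 / (2 * u l * v l * V l $ 2) = s / ((\<kappa> l - 1) * V l $ 2)"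
    unfolding s_def assms(3)[symmetric] using uv by (simp add: power2_eq_square)
  have l: "lambda1 u v \<kappa> V \<mu> l = s * (1 + m * (\<mu> + V l $ 1))"
    "lambda2 u v \<kappa> V \<mu> l = s * (1 + m * (V l $ 1 - \<mu>))"
    unfolding lambda1_def lambda2_def s m_def using assms(2,5)
    by (simp_all add: divide_simps) (simp_all add: algebra_simps)
  define n where "n = 1 / (2 * \<mu>)"
  show ?thesis
    unfolding row_step_def Let_def m_def[symmetric] s_def[symmetric] l Q_mat_def scale_mat2
      mat2_mult mat2_eq_iff n_def[symmetric]
    by (intro conjI; (use mu in algebra | simp add: algebra_simps))
qed

section \<open>Closed form of the frame\<close>

lemma frame_formulas_of_recursion:
  fixes \<rho> :: "nat \<Rightarrow> complex^2^2"
  assumes nz: "\<And>j. \<kappa> j \<noteq> 0" "\<And>j. \<kappa> j \<noteq> 1"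
    and sq: "\<And>j. u j ^ 2 = \<kappa> j - 1" "\<And>j. v j ^ 2 = \<kappa> j"
    and V: "\<And>k. V (k + 1) v* Ad (K_mat u v \<kappa> k) = V k" "\<And>k. V k $ 2 \<noteq> 0"
    and mu: "\<mu> ^ 2 = (cs $ 1) ^ 2 + 4 * cs $ 2 * cs $ 3" "cs $ 3 * \<mu> \<noteq> 0"
    and rec: "\<And>k. \<rho> (Suc k) = K_mat u v \<kappa> (int k) ** \<rho> k"
    and init: "det (\<rho> 0) = 1" "cs = V 0 v* Ad (\<rho> 0)"
  shows "frame_formulas u v \<kappa> V cs \<mu> (\<lambda>k. \<rho> k $ 1 $ 1) (\<lambda>k. \<rho> k $ 1 $ 2)
      (\<lambda>k. \<rho> k $ 2 $ 1) (\<lambda>k. \<rho> k $ 2 $ 2)"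
proof -
  have det: "det (\<rho> k) = 1" for k
    by (induction k) (simp_all add: init rec det_mul det_K_mat nz sq)
  have const: "cs = V (int k) v* Ad (\<rho> k)" for k
  proof (induction k)
    case (Suc k)
    have "V (int (Suc k)) v* Ad (\<rho> (Suc k)) = V (int k + 1) v* Ad (K_mat u v \<kappa> (int k)) v* Ad (\<rho> k)"
      by (simp add: rec Ad_mult vector_matrix_mul_assoc add.commute)
    thus ?case using Suc V(1) by simp
  qed (use init in simp)
  have lin: "2 * \<rho> k $ 1 $ 2 * V (int k) $ 2 - 2 * \<rho> k $ 2 $ 1 * cs $ 3
        + (cs $ 1 - V (int k) $ 1) * \<rho> k $ 2 $ 2 = 0"
    "2 * \<rho> k $ 1 $ 1 * V (int k) $ 2 - \<rho> k $ 2 $ 1 * (cs $ 1 + V (int k) $ 1)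
        - 2 * cs $ 2 * \<rho> k $ 2 $ 2 = 0" for k
    using Ad_linear_relations[of "\<rho> k $ 1 $ 1" "\<rho> k $ 2 $ 2" "\<rho> k $ 1 $ 2" "\<rho> k $ 2 $ 1" cs "V (int k)"]
      det[of k] const[of k] by (simp_all add: det_2 flip: mat2_eta)
  have step: "vector [\<rho> (Suc k) $ 2 $ 1, \<rho> (Suc k) $ 2 $ 2] =
      row_step u v \<kappa> V cs (int k) *v vector [\<rho> k $ 2 $ 1, \<rho> k $ 2 $ 2]" for k
    by (rule second_row_step[where a = "\<rho> k $ 1 $ 1" and b = "\<rho> k $ 1 $ 2"
          and a' = "\<rho> (Suc k) $ 1 $ 1" and b' = "\<rho> (Suc k) $ 1 $ 2"])
       (simp_all add: V(2) lin rec flip: mat2_eta)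
  have detQ: "det (Q_mat cs \<mu>) \<noteq> 0"
    using mu(2) by (auto simp: Q_mat_def scale_mat2 det_mat2 field_simps)
  have "vector [\<rho> k $ 2 $ 1, \<rho> k $ 2 $ 2] =
       (Q_mat cs \<mu>
         ** mat2 (\<Prod>l<k. lambda1 u v \<kappa> V \<mu> (int l)) 0 0 (\<Prod>l<k. lambda2 u v \<kappa> V \<mu> (int l))
         ** matrix_inv (Q_mat cs \<mu>)) *v vector [\<rho> 0 $ 2 $ 1, \<rho> 0 $ 2 $ 2]" for k
  proof (induction k)
    case 0
    show ?case using matrix_inv_mult[OF detQ] by (simp flip: mat_1_mat2)
  next
    case (Suc k)
    let ?D = "\<lambda>k. mat2 (\<Prod>l<k. lambda1 u v \<kappa> V \<mu> (int l)) 0 0 (\<Prod>l<k. lambda2 u v \<kappa> V \<mu> (int l))"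
    let ?r0 = "vector [\<rho> 0 $ 2 $ 1, \<rho> 0 $ 2 $ 2]"
    have "mat2 (lambda1 u v \<kappa> V \<mu> (int k)) 0 0 (lambda2 u v \<kappa> V \<mu> (int k)) ** ?D k = ?D (Suc k)"
      by (simp add: mat2_mult mult.commute)
    hence "row_step u v \<kappa> V cs (int k) ** (Q_mat cs \<mu> ** ?D k) = Q_mat cs \<mu> ** ?D (Suc k)"
      by (simp add: matrix_mul_assoc row_step_Q nz sq V(2) mu(1)) (simp flip: matrix_mul_assoc)
    thus ?case
      unfolding step Suc.IH by (simp add: matrix_vector_mul_assoc matrix_mul_assoc)
  qed
  thus ?thesis unfolding frame_formulas_def using lin by blast
qed

lemma frame_formulas_unique:
  assumes "frame_formulas u v \<kappa> V cs \<mu> a b c d" "frame_formulas u v \<kappa> V cs \<mu> a' b' c' d'"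
    and "c 0 = c' 0" "d 0 = d' 0" and V: "\<And>k. V k $ 2 \<noteq> 0"
  shows "a k = a' k" "b k = b' k" "c k = c' k" "d k = d' k"
proof -
  have "(vector [c k, d k] :: complex^2) = vector [c' k, d' k]"
    using assms(1-4) unfolding frame_formulas_def by metis
  thus c: "c k = c' k" and d: "d k = d' k"
    by (auto simp: vec_eq_iff forall_2)
  have eq: "2 * b k * V (int k) $ 2 - 2 * c k * cs $ 3 + (cs $ 1 - V (int k) $ 1) * d k = 0"
    "2 * b' k * V (int k) $ 2 - 2 * c' k * cs $ 3 + (cs $ 1 - V (int k) $ 1) * d' k = 0"
    "2 * a k * V (int k) $ 2 - c k * (cs $ 1 + V (int k) $ 1) - 2 * cs $ 2 * d k = 0"
    "2 * a' k * V (int k) $ 2 - c' k * (cs $ 1 + V (int k) $ 1) - 2 * cs $ 2 * d' k = 0"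
    using assms(1,2) unfolding frame_formulas_def by auto
  have "V (int k) $ 2 * (a k - a' k) = 0" "V (int k) $ 2 * (b k - b' k) = 0"
    using eq unfolding c d by algebra+
  thus "a k = a' k" "b k = b' k" using V by auto
qed

section \<open>The cross ratio of the reconstructed points\<close>

text \<open>For two linear forms in affine coordinates, the determinant of the coefficients is a multiple of
  the difference of their zeros, and it is invariant under \<open>SL(2)\<close>. The cross ratio is a quotient of
  such determinants in which the normalisation of the forms cancels.\<close>

definition wedge :: "complex^2 \<Rightarrow> complex^2 \<Rightarrow> complex" where
  "wedge r s = r $ 1 * s $ 2 - r $ 2 * s $ 1"

lemma wedge_mult: "wedge (r v* g) (s v* g) = wedge r s * det g"
  by (simp add: wedge_def det_2 vector_matrix_mult_def sum_2 algebra_simps)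

lemma wedge_scale: "wedge r (t *s s) = t * wedge r s"
  by (simp add: wedge_def algebra_simps)

lemma wedge_swap: "wedge r s = - wedge s r"
  by (simp add: wedge_def)

lemma diff_eq_wedge:
  assumes "r $ 1 \<noteq> 0" "s $ 1 \<noteq> 0"
  shows "- r $ 2 / r $ 1 - - s $ 2 / s $ 1 = wedge r s / (r $ 1 * s $ 1)"
  using assms by (simp add: wedge_def divide_simps)

text \<open>The point \<open>x k\<close> is the zero of the form \<open>w \<rho>\<^sub>k\<close>. By invariance the factor \<open>\<rho>\<^sub>k\<close> drops out
  of all determinants, and the rows computed for the conservation laws give their values. The
  factors \<open>s\<close> and \<open>t\<close> of these rows satisfy \<open>s t = 1\<close>. No two of the points that occur in a
  denominator coincide, because the determinants are nonzero.\<close>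

lemma cross_ratio_of_frame:
  fixes \<rho> :: "nat \<Rightarrow> complex^2^2"
  assumes nz: "\<And>j. \<kappa> j \<noteq> 0" "\<And>j. \<kappa> j \<noteq> 1"
    and sq: "\<And>j. u j ^ 2 = \<kappa> j - 1" "\<And>j. v j ^ 2 = \<kappa> j"
    and rec: "\<And>k. \<rho> (Suc k) = K_mat u v \<kappa> (int k) ** \<rho> k"
    and det0: "det (\<rho> 0) = 1"
    and x: "\<And>k. (frame_row v* \<rho> k) $ 1 \<noteq> 0"
      "\<And>k. x (int k) = - (frame_row v* \<rho> k) $ 2 / (frame_row v* \<rho> k) $ 1"
  shows "cross_ratio x (int k) = \<kappa> (int k)"
proof -
  define r where "r k = frame_row v* \<rho> k" for k
  define s where "s j = u j / (2 * v j)" for j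
  define t where "t j = s j * (4 * \<kappa> j / (\<kappa> j - 1))" for j
  have s0: "s j \<noteq> 0" for j using nz[of j] sq[of j] by (auto simp: s_def)
  have t0: "t j \<noteq> 0" for j using nz[of j] s0[of j] by (auto simp: t_def)
  have st: "s j * t j = 1" for j
  proof -
    have "s j * t j = (u j / (2 * v j)) ^ 2 * (4 * \<kappa> j / (\<kappa> j - 1))"
      unfolding s_def t_def power2_eq_square mult.assoc ..
    also have "\<dots> = 1"
      unfolding power_divide power_mult_distrib sq using nz[of j] by simp
    finally show ?thesis .
  qed
  have det: "det (\<rho> k) = 1" for k
    by (induction k) (simp_all add: det0 rec det_mul det_K_mat nz sq)
  have w1: "wedge (r k) (r (Suc k)) = t (int k) / 2" for k
  proof -
    have "r (Suc k) = (frame_row v* K_mat u v \<kappa> (int k)) v* \<rho> k"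
      by (simp add: r_def rec vector_matrix_mul_assoc)
    hence "wedge (r k) (r (Suc k)) = wedge frame_row (frame_row v* K_mat u v \<kappa> (int k))"
      unfolding r_def by (simp add: wedge_mult det)
    also have "\<dots> = t (int k) / 2"
      unfolding frame_row_mult_K[OF nz(2)] wedge_scale by (simp add: wedge_def t_def s_def)
    finally show ?thesis .
  qed
  have w3: "wedge (r k) (r (k + 3)) =
      t (int k + 2) * s (int k + 1) * s (int k) * (- 2 / (\<kappa> (int k) - 1))"
  proof -
    have "r (k + 3) = (frame_row v* K_mat u v \<kappa> (int k + 2) v* K_mat u v \<kappa> (int k + 1)
        v* K_mat u v \<kappa> (int k)) v* \<rho> k"
      by (simp add: r_def rec vector_matrix_mul_assoc matrix_mul_assoc numeral_3_eq_3 add.commute)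
    hence "wedge (r k) (r (k + 3)) = wedge frame_row (frame_row v* K_mat u v \<kappa> (int k + 2)
        v* K_mat u v \<kappa> (int k + 1) v* K_mat u v \<kappa> (int k))"
      by (simp add: r_def[of k] wedge_mult det)
    also have "\<dots> = t (int k + 2) * s (int k + 1) * s (int k) *
        wedge frame_row (vector [- (2 * \<kappa> (int k) + 2) / (\<kappa> (int k) - 1), 1])"
      unfolding frame_row_mult_K_K[OF nz(2)] wedge_scale by (simp add: t_def s_def)
    also have "wedge frame_row (vector [- (2 * \<kappa> (int k) + 2) / (\<kappa> (int k) - 1), 1])
        = - 2 / (\<kappa> (int k) - 1)"
      using nz(2)[of "int k"] by (simp add: wedge_def divide_simps)
    finally show ?thesis .
  qed
  have d: "x (int i) - x (int j) = wedge (r i) (r j) / (r i $ 1 * r j $ 1)" for i j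
    unfolding x(2) r_def by (rule diff_eq_wedge[OF x(1) x(1)])
  have w2: "wedge (r (k + 2)) (r (k + 3)) = t (int k + 2) / 2"
    "wedge (r (k + 2)) (r (k + 1)) = - t (int k + 1) / 2"
    using w1[of "k + 2"] w1[of "k + 1"] wedge_swap[of "r (k + 2)" "r (k + 1)"]
    by (simp_all add: add.commute numeral_3_eq_3)
  have r0: "r k $ 1 \<noteq> 0" for k using x(1) by (simp add: r_def)
  have e: "int k + 1 = int (k + 1)" "int k + 2 = int (k + 2)" "int k + 3 = int (k + 3)" by simp_all
  have "cross_ratio x (int k) =
      (wedge (r k) (r (k + 1)) * wedge (r (k + 2)) (r (k + 3))) /
      (wedge (r k) (r (k + 3)) * wedge (r (k + 2)) (r (k + 1)))"
    unfolding cross_ratio_def e d using r0[of k] r0[of "k+1"] r0[of "k+2"] r0[of "k+3"]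
    by (simp add: divide_simps)
  also have "\<dots> = \<kappa> (int k) / (s (int k + 1) * t (int k + 1))"
    unfolding w2 w3 using w1[of k] t0[of "int k"] t0[of "int k + 1"] t0[of "int k + 2"]
      s0[of "int k"] s0[of "int k + 1"] nz[of "int k"]
    by (simp add: t_def[of "int k"] divide_simps)
  finally show ?thesis by (simp add: st)
qed

section \<open>The moving frame of a solution\<close>

lemma moving_frame_eq:
  "moving_frame p q x k = (let P = p k / (q k * q (k + 1)) in
     mat2 (P * (1/2)) (P * (- x (k + 1) / 2))
       (P * ((x (k + 2) - 2 * x (k + 1) + x k) / (x k - x (k + 2))))
       (P * ((x k * x (k + 1) - 2 * x k * x (k + 2) + x (k + 1) * x (k + 2)) / (x k - x (k + 2)))))"
  by (simp add: moving_frame_def scale_mat2 Let_def)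

lemma det_moving_frame:
  assumes "x k \<noteq> x (k + 1)" "x k \<noteq> x (k + 2)" "x (k + 1) \<noteq> x (k + 2)"
    and "p k ^ 2 = x k - x (k + 2)" "q k ^ 2 = x k - x (k + 1)"
      "q (k + 1) ^ 2 = x (k + 1) - x (k + 2)"
  shows "det (moving_frame p q x k) = 1"
proof -
  have "det (moving_frame p q x k) = (p k / (q k * q (k + 1))) ^ 2 *
     ((x k * x (k + 1) - 2 * x k * x (k + 2) + x (k + 1) * x (k + 2)) / (x k - x (k + 2)) / 2 +
      x (k + 1) / 2 * ((x (k + 2) - 2 * x (k + 1) + x k) / (x k - x (k + 2))))"
  proof -
    have "P * (1/2) * (P * Y) - P * (- y / 2) * (P * Z) = P ^ 2 * (Y / 2 + y / 2 * Z)"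
      for P y Y Z :: complex by (simp add: algebra_simps power2_eq_square)
    thus ?thesis unfolding moving_frame_eq Let_def det_mat2 .
  qed
  also have "\<dots> = 1"
    unfolding power_divide power_mult_distrib assms(4-6) using assms(1-3)
    by (simp add: divide_simps) (simp add: algebra_simps)
  finally show ?thesis .
qed

text \<open>By the definition of the frame \<open>\<rho>\<^sub>k\<^sub>+\<^sub>1 \<rho>\<^sub>k\<^sup>-\<^sup>1\<close> is invariant. The identity below holds up to
  the scalar in front of the matrices by the formula for \<open>\<kappa>\<close> as cross ratio; the hypothesis on
  \<open>u / v\<close> makes the scalars agree exactly and not only up to sign.\<close>

lemma moving_frame_step:
  assumes ne: "\<And>k. x k \<noteq> x (k + 1)" "\<And>k. x k \<noteq> x (k + 2)" "\<And>k. x k \<noteq> x (k + 3)"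
    and \<kappa>: "cross_ratio x k = \<kappa> k" "\<kappa> k \<noteq> 1"
    and pq: "\<And>k. p k ^ 2 = x k - x (k + 2)" "\<And>k. q k ^ 2 = x k - x (k + 1)"
    and sign: "u k / v k = (p k * p (k + 1)) / (q k * q (k + 2))"
  shows "moving_frame p q x (k + 1) = K_mat u v \<kappa> k ** moving_frame p q x k"
proof -
  define x0 x1 x2 x3 where X: "x0 = x k" "x1 = x (k + 1)" "x2 = x (k + 2)" "x3 = x (k + 3)"
  have e: "k + 1 + 1 = k + 2" "k + 1 + 2 = k + 3" by simp_all
  have n: "x0 \<noteq> x1" "x0 \<noteq> x2" "x0 \<noteq> x3" "x1 \<noteq> x2" "x1 \<noteq> x3"
    using ne(1)[of k] ne(2)[of k] ne(3)[of k] ne(1)[of "k+1"] ne(2)[of "k+1"]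
    by (simp_all add: X add.assoc)
  define P where "P = p (k + 1) / (q (k + 1) * q (k + 2))"
  have q0: "q k \<noteq> 0" "q (k + 1) \<noteq> 0"
    using pq(2)[of k] pq(2)[of "k+1"] n by (auto simp: X e)
  have s: "u k / (2 * v k) * (p k / (q k * q (k + 1))) = P * ((x0 - x2) / (2 * (x0 - x1)))"
  proof -
    have "u k / (2 * v k) * (p k / (q k * q (k + 1))) = (u k / v k) * p k / (2 * q k * q (k + 1))"
      by simp
    also have "\<dots> = P * (p k ^ 2 / (2 * q k ^ 2))"
      unfolding sign by (simp add: P_def power2_eq_square mult_ac)
    finally show ?thesis by (simp add: pq X)
  qed
  have K: "- (6 * \<kappa> k + 2) / (\<kappa> k - 1) =
      - (6 * ((x0 - x1) * (x2 - x3)) + 2 * ((x0 - x3) * (x2 - x1))) / ((x0 - x2) * (x1 - x3))"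
  proof -
    have k: "\<kappa> k = ((x0 - x1) * (x2 - x3)) / ((x0 - x3) * (x2 - x1))"
      using \<kappa>(1) by (simp add: cross_ratio_def X)
    \<comment> \<open>a Pluecker relation between the differences of four points\<close>
    have k1: "\<kappa> k - 1 = ((x0 - x2) * (x1 - x3)) / ((x0 - x3) * (x2 - x1))"
      unfolding k using n by (simp add: divide_simps) (simp add: algebra_simps)
    show ?thesis unfolding k1 unfolding k using n by (simp add: divide_simps)
  qed
  have "K_mat u v \<kappa> k ** moving_frame p q x k =
      mat (u k / (2 * v k) * (p k / (q k * q (k + 1)))) **
      (mat2 1 (1/2) (- (6 * \<kappa> k + 2) / (\<kappa> k - 1)) 1 **
       mat2 (1/2) (- x1 / 2) ((x2 - 2 * x1 + x0) / (x0 - x2))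
         ((x0 * x1 - 2 * x0 * x2 + x1 * x2) / (x0 - x2)))"
    unfolding K_mat_def moving_frame_def X scale_mat2 mat2_mult mat2_eq_iff by algebra
  also have "\<dots> = mat P ** mat2 (1/2) (- x2 / 2) ((x3 - 2 * x2 + x1) / (x1 - x3))
         ((x1 * x2 - 2 * x1 * x3 + x2 * x3) / (x1 - x3))"
    unfolding s K scale_mat2 mat2_mult mat2_eq_iff mult.assoc[of P]
    using n by (intro conjI arg_cong[where f = "(*) P"]) (simp add: divide_simps, simp add: algebra_simps)+
  also have "\<dots> = moving_frame p q x (k + 1)"
    unfolding moving_frame_def P_def X e ..
  finally show ?thesis ..
qed

lemma moving_frame_normalises:
  assumes "x k \<noteq> x (k + 1)" "x k \<noteq> x (k + 2)" "x (k + 1) \<noteq> x (k + 2)"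
    and "p k ^ 2 = x k - x (k + 2)" "q k ^ 2 = x k - x (k + 1)"
      "q (k + 1) ^ 2 = x (k + 1) - x (k + 2)"
  defines "\<rho> \<equiv> moving_frame p q x k"
  shows "2 * \<rho> $ 1 $ 1 - \<rho> $ 2 $ 1 \<noteq> 0 \<and>
     x k = (\<rho> $ 2 $ 2 - 2 * \<rho> $ 1 $ 2) / (2 * \<rho> $ 1 $ 1 - \<rho> $ 2 $ 1)"
proof -
  define P where "P = p k / (q k * q (k + 1))"
  have "p k \<noteq> 0" "q k \<noteq> 0" "q (k + 1) \<noteq> 0"
    using assms(1-6) by (metis power_zero_numeral right_minus_eq)+
  hence P: "P \<noteq> 0" by (simp add: P_def)
  define h where "h = 2 * P * (x (k + 1) - x (k + 2)) / (x k - x (k + 2))"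
  have "2 * \<rho> $ 1 $ 1 - \<rho> $ 2 $ 1 = h"
    unfolding \<rho>_def moving_frame_eq Let_def P_def[symmetric] h_def mat2_nth using assms(2)
    by (simp add: divide_simps) (simp add: algebra_simps)
  moreover have "\<rho> $ 2 $ 2 - 2 * \<rho> $ 1 $ 2 = x k * h"
    unfolding \<rho>_def moving_frame_eq Let_def P_def[symmetric] h_def mat2_nth using assms(2)
    by (simp add: divide_simps) (simp add: algebra_simps)
  moreover have "h \<noteq> 0" using P assms(2,3) by (simp add: h_def)
  ultimately show ?thesis by simp
qed

section \<open>Solutions in the original variable\<close>

theorem mainTheorem4:
  fixes \<F> :: "complex set" and J :: nat and L :: "complex list \<Rightarrow> complex"
    and \<kappa> u v :: "int \<Rightarrow> complex" and cs :: "complex^3" and \<mu> :: complex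
    and V :: "int \<Rightarrow> complex^3"
  assumes "\<F> = \<real> \<or> \<F> = UNIV"
    and "\<And>k. \<kappa> k \<in> \<F>"
    and "\<And>k. \<kappa> k \<noteq> 0" and "\<And>k. \<kappa> k \<noteq> 1"
    and "\<And>k j. j \<le> J \<Longrightarrow> \<exists>D. has_partial \<F> L j (jet J \<kappa> k) D"
    and "euler_lagrange \<F> J L \<kappa>"
    and "\<And>k. u k ^ 2 = \<kappa> k - 1" and "\<And>k. v k ^ 2 = \<kappa> k"
    and V_def: "V = V_inv \<F> J L u v \<kappa>"
    and "\<mu> ^ 2 = (cs $ 1) ^ 2 + 4 * cs $ 2 * cs $ 3"
    and "\<And>k. V k $ 2 \<noteq> 0"
    and "cs $ 3 * \<mu> \<noteq> 0"
  shows
    \<comment> \<open>First conjunct: every solution with invariants \<open>\<kappa>\<close> and constants \<open>cs\<close> is given by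
      the formulas. The hypothesis relating \<open>u\<close>, \<open>v\<close> to \<open>p\<close>, \<open>q\<close> is the consistency of signs:
      both sides are square roots of \<open>(\<kappa> k - 1) / \<kappa> k\<close>. Second conjunct: for admissible initial
      data the formulas define a solution wherever they make sense.\<close>
    "(\<forall>x p q :: int \<Rightarrow> complex.
       (\<forall>k. x k \<noteq> x (k + 1) \<and> x k \<noteq> x (k + 2) \<and> x k \<noteq> x (k + 3)) \<and>
       (\<forall>k. cross_ratio x k = \<kappa> k) \<and>
       (\<forall>k. p k ^ 2 = x k - x (k + 2)) \<and> (\<forall>k. q k ^ 2 = x k - x (k + 1)) \<and>
       (\<forall>k. u k / v k = (p k * p (k + 1)) / (q k * q (k + 2))) \<and>
       cs = V 0 v* Ad (moving_frame p q x 0) \<longrightarrow>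
       (\<exists>a b c d :: nat \<Rightarrow> complex.
          (\<forall>k. moving_frame p q x (int k) = mat2 (a k) (b k) (c k) (d k)) \<and>
          frame_formulas u v \<kappa> V cs \<mu> a b c d \<and>
          (\<forall>k. 2 * a k - c k \<noteq> 0 \<and>
               x (int k) = proj_act (matrix_inv (moving_frame p q x (int k))) (1/2) \<and>
               x (int k) = (d k - 2 * b k) / (2 * a k - c k))))
     \<and>
    (\<forall>(a :: nat \<Rightarrow> complex) b c d (x :: int \<Rightarrow> complex).
       frame_formulas u v \<kappa> V cs \<mu> a b c d \<and>
       det (mat2 (a 0) (b 0) (c 0) (d 0)) = 1 \<and>
       cs = V 0 v* Ad (mat2 (a 0) (b 0) (c 0) (d 0)) \<and>
       (\<forall>k. 2 * a k - c k \<noteq> 0 \<and> x (int k) = (d k - 2 * b k) / (2 * a k - c k)) \<longrightarrow>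
       (\<forall>k. cross_ratio x (int k) = \<kappa> (int k)))"
proof (intro conjI allI impI; (elim conjE)?)
  note nz = assms(3) assms(4) and sq = assms(7) assms(8) and mu = assms(10) assms(12)
  have V1: "V (k + 1) v* Ad (K_mat u v \<kappa> k) = V k" for k
    unfolding V_def by (rule V_inv_step[OF nz sq assms(6)])
  note V = V1 assms(11)
  {
    fix x p q :: "int \<Rightarrow> complex"
    assume ne: "\<forall>k. x k \<noteq> x (k + 1) \<and> x k \<noteq> x (k + 2) \<and> x k \<noteq> x (k + 3)"
      and \<kappa>: "\<forall>k. cross_ratio x k = \<kappa> k"
      and pq: "\<forall>k. p k ^ 2 = x k - x (k + 2)" "\<forall>k. q k ^ 2 = x k - x (k + 1)"
      and sign: "\<forall>k. u k / v k = (p k * p (k + 1)) / (q k * q (k + 2))"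
      and cs: "cs = V 0 v* Ad (moving_frame p q x 0)"
    define \<rho> where "\<rho> k = moving_frame p q x (int k)" for k
    have e: "k + 1 + 1 = k + 2" for k :: int by simp
    have ne1: "x (k + 1) \<noteq> x (k + 2)" and q1: "q (k + 1) ^ 2 = x (k + 1) - x (k + 2)" for k
      using ne[rule_format, of "k + 1"] pq(2)[rule_format, of "k + 1"] unfolding e by auto
    have det: "det (moving_frame p q x k) = 1" for k
      by (rule det_moving_frame) (use ne ne1 pq q1 in auto)
    have rec: "\<rho> (Suc k) = K_mat u v \<kappa> (int k) ** \<rho> k" for k
      using moving_frame_step[of x "int k" \<kappa> p q u v] ne \<kappa> nz(2) pq sign
      by (simp add: \<rho>_def add.commute)
    have F: "frame_formulas u v \<kappa> V cs \<mu> (\<lambda>k. \<rho> k $ 1 $ 1) (\<lambda>k. \<rho> k $ 1 $ 2)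
      (\<lambda>k. \<rho> k $ 2 $ 1) (\<lambda>k. \<rho> k $ 2 $ 2)"
      by (rule frame_formulas_of_recursion[OF nz sq V mu rec]) (use det cs in \<open>simp_all add: \<rho>_def\<close>)
    have row: "2 * \<rho> k $ 1 $ 1 - \<rho> k $ 2 $ 1 \<noteq> 0 \<and>
        x (int k) = (\<rho> k $ 2 $ 2 - 2 * \<rho> k $ 1 $ 2) / (2 * \<rho> k $ 1 $ 1 - \<rho> k $ 2 $ 1)" for k
      unfolding \<rho>_def by (rule moving_frame_normalises) (use ne ne1 pq q1 in auto)
    have pt: "x (int k) = proj_act (matrix_inv (\<rho> k)) (1/2)" for k
    proof -
      have "matrix_inv (\<rho> k) = mat2 (\<rho> k $ 2 $ 2) (- \<rho> k $ 1 $ 2) (- \<rho> k $ 2 $ 1) (\<rho> k $ 1 $ 1)"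
        using det[of "int k"] by (subst mat2_eta[of "\<rho> k"], intro matrix_inv_mat2) (simp add: \<rho>_def det_2)
      hence "proj_act (matrix_inv (\<rho> k)) (1/2) =
          (\<rho> k $ 2 $ 2 / 2 - \<rho> k $ 1 $ 2) / (\<rho> k $ 1 $ 1 - \<rho> k $ 2 $ 1 / 2)"
        by (simp add: proj_act_def moebius_def)
      also have "\<dots> = (2 * (\<rho> k $ 2 $ 2 / 2 - \<rho> k $ 1 $ 2)) / (2 * (\<rho> k $ 1 $ 1 - \<rho> k $ 2 $ 1 / 2))"
        by (rule mult_divide_mult_cancel_left[symmetric]) simp
      also have "\<dots> = (\<rho> k $ 2 $ 2 - 2 * \<rho> k $ 1 $ 2) / (2 * \<rho> k $ 1 $ 1 - \<rho> k $ 2 $ 1)"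
        by (simp add: right_diff_distrib)
      finally show ?thesis using row[of k] by simp
    qed
    show "\<exists>a b c d :: nat \<Rightarrow> complex.
          (\<forall>k. moving_frame p q x (int k) = mat2 (a k) (b k) (c k) (d k)) \<and>
          frame_formulas u v \<kappa> V cs \<mu> a b c d \<and>
          (\<forall>k. 2 * a k - c k \<noteq> 0 \<and>
               x (int k) = proj_act (matrix_inv (moving_frame p q x (int k))) (1/2) \<and>
               x (int k) = (d k - 2 * b k) / (2 * a k - c k))"
      unfolding \<rho>_def[symmetric]
      by (rule exI[of _ "\<lambda>k. \<rho> k $ 1 $ 1"], rule exI[of _ "\<lambda>k. \<rho> k $ 1 $ 2"],
          rule exI[of _ "\<lambda>k. \<rho> k $ 2 $ 1"], rule exI[of _ "\<lambda>k. \<rho> k $ 2 $ 2"],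
          intro conjI allI)
         (rule mat2_eta F pt row[THEN conjunct1] row[THEN conjunct2])+
  next
    fix a b c d :: "nat \<Rightarrow> complex" and x :: "int \<Rightarrow> complex" and k :: nat
    assume F: "frame_formulas u v \<kappa> V cs \<mu> a b c d"
      and det: "det (mat2 (a 0) (b 0) (c 0) (d 0)) = 1"
      and cs: "cs = V 0 v* Ad (mat2 (a 0) (b 0) (c 0) (d 0))"
      and x: "\<forall>k. 2 * a k - c k \<noteq> 0 \<and> x (int k) = (d k - 2 * b k) / (2 * a k - c k)"
    define \<rho> where "\<rho> = rec_nat (mat2 (a 0) (b 0) (c 0) (d 0)) (\<lambda>k g. K_mat u v \<kappa> (int k) ** g)"
    have init: "\<rho> 0 = mat2 (a 0) (b 0) (c 0) (d 0)"
      and rec: "\<rho> (Suc k) = K_mat u v \<kappa> (int k) ** \<rho> k" for k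
      by (simp_all add: \<rho>_def)
    have F': "frame_formulas u v \<kappa> V cs \<mu> (\<lambda>k. \<rho> k $ 1 $ 1) (\<lambda>k. \<rho> k $ 1 $ 2)
      (\<lambda>k. \<rho> k $ 2 $ 1) (\<lambda>k. \<rho> k $ 2 $ 2)"
      by (rule frame_formulas_of_recursion[OF nz sq V mu rec]) (use det cs in \<open>simp_all add: init\<close>)
    have "c 0 = \<rho> 0 $ 2 $ 1" "d 0 = \<rho> 0 $ 2 $ 2" by (simp_all add: init)
    note uniq = frame_formulas_unique[OF F F' this V(2)]
    have \<rho>: "\<rho> k = mat2 (a k) (b k) (c k) (d k)" for k
      unfolding uniq by (rule mat2_eta)
    have row: "frame_row v* \<rho> k = vector [(2 * a k - c k) / 2, - ((d k - 2 * b k) / 2)]" for k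
      by (simp add: \<rho> vector_mult_mat2 diff_divide_distrib)
    show "cross_ratio x (int k) = \<kappa> (int k)"
    proof (rule cross_ratio_of_frame[OF nz sq rec])
      show "det (\<rho> 0) = 1" using det by (simp add: init)
      show "(frame_row v* \<rho> k) $ 1 \<noteq> 0" for k using x by (simp add: row)
      show "x (int k) = - (frame_row v* \<rho> k) $ 2 / (frame_row v* \<rho> k) $ 1" for k
      proof -
        have "- (- (y / 2)) / (z / 2) = y / z" for y z :: complex by (cases "z = 0") simp_all
        note half = this[of "d k - 2 * b k" "2 * a k - c k"]
        show ?thesis unfolding row vector_2 half using x by blast
      qed
    qed
  }
qed

end
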